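(* Let $\Sigma$ be an implicational base over a finite set $U$ with closure system $\mathcal{C}$, and let $(U_1,U_2)$ be a split of $\Sigma$. Let $\mathcal{C}_1$ and $\mathcal{C}_2$ be the closure systems (over $U_1$ and $U_2$ respectively) of $\Sigma[U_1]$ and $\Sigma[U_2]$. Then: (1) for every $C\in\mathcal{C}$, $C\cap U_1\in\mathcal{C}_1$ and $C\cap U_2\in\mathcal{C}_2$; hence $\mathcal{C}\subseteq\mathcal{C}_1\times\mathcal{C}_2$; (2) if $\Sigma[U_1,U_2]=\emptyset$, then $\mathcal{C}=\mathcal{C}_1\times\mathcal{C}_2$; (3) if $A\subseteq U_1$ for every implication $A\to b$ of $\Sigma[U_1,U_2]$, then $\mathcal{C}:U_1=\mathcal{C}_1$ and $\mathcal{C}:U_2=\mathcal{C}_2$; (4) if $A\subseteq U_2$ for every implication $A\to b$ of $\Sigma[U_1,U_2]$, then $\mathcal{C}:U_1=\mathcal{C}_1$ and $\mathcal{C}:U_2=\mathcal{C}_2$.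
   Context: An implication over $U$ is written $A \to b$ with $A \subseteq U$ nonempty and $b \in U$; an implicational base over $U$ is a finite set of implications over $U$. A set $C\subseteq U$ satisfies $\Sigma$ if for every $A\to b\in\Sigma$, $A\subseteq C$ implies $b\in C$; the closure system of $\Sigma$ is the family of all subsets of $U$ satisfying $\Sigma$. For $X\subseteq U$, $\Sigma[X]=\{A\to b\in\Sigma: A\cup\{b\}\subseteq X\}$ (a base over $X$). A split of $\Sigma$ is a bipartition $(U_1,U_2)$ of $U$ into two nonempty disjoint sets such that every premise $A$ of an implication of $\Sigma$ satisfies $A\subseteq U_1$ or $A\subseteq U_2$; then $\Sigma[U_1,U_2]:=\Sigma\setminus(\Sigma[U_1]\cup\Sigma[U_2])$. For families $\mathcal{C}_1,\mathcal{C}_2$ over disjoint $U_1,U_2$, the direct product is $\mathcal{C}_1\times\mathcal{C}_2=\{C_1\cup C_2: C_1\in\mathcal{C}_1, C_2\in\mathcal{C}_2\}$. The trace of a family $\mathcal{S}$ on $U'$ is $\mathcal{S}:U'=\{S\cap U' : S\in\mathcal{S}\}$. *)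

theory Defs
  imports Main
begin

text \<open>An implication \<open>A \<rightarrow> b\<close> is represented by the pair \<open>(A, b)\<close>.\<close>

type_synonym 'a implication = "'a set \<times> 'a"

definition implicational_base :: "'a set \<Rightarrow> 'a implication set \<Rightarrow> bool" where
  "implicational_base U \<Sigma> \<longleftrightarrow>
     finite \<Sigma> \<and> (\<forall>(A, b) \<in> \<Sigma>. A \<noteq> {} \<and> A \<subseteq> U \<and> b \<in> U)"

definition satisfies :: "'a set \<Rightarrow> 'a implication set \<Rightarrow> bool" where
  "satisfies C \<Sigma> \<longleftrightarrow> (\<forall>(A, b) \<in> \<Sigma>. A \<subseteq> C \<longrightarrow> b \<in> C)"

definition closure_system :: "'a set \<Rightarrow> 'a implication set \<Rightarrow> 'a set set" where
  "closure_system U \<Sigma> = {C. C \<subseteq> U \<and> satisfies C \<Sigma>}"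

definition restrict_base :: "'a implication set \<Rightarrow> 'a set \<Rightarrow> 'a implication set" where
  "restrict_base \<Sigma> X = {(A, b). (A, b) \<in> \<Sigma> \<and> A \<union> {b} \<subseteq> X}"

definition is_split :: "'a set \<Rightarrow> 'a implication set \<Rightarrow> 'a set \<Rightarrow> 'a set \<Rightarrow> bool" where
  "is_split U \<Sigma> U1 U2 \<longleftrightarrow>
     U1 \<noteq> {} \<and> U2 \<noteq> {} \<and> U1 \<inter> U2 = {} \<and> U1 \<union> U2 = U \<and>
     (\<forall>(A, b) \<in> \<Sigma>. A \<subseteq> U1 \<or> A \<subseteq> U2)"

definition cross_base :: "'a implication set \<Rightarrow> 'a set \<Rightarrow> 'a set \<Rightarrow> 'a implication set" where
  "cross_base \<Sigma> U1 U2 = \<Sigma> - (restrict_base \<Sigma> U1 \<union> restrict_base \<Sigma> U2)"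

text \<open>The direct product consists of unions, not of pairs as in \<open>\<times>\<close>;
  it is only meant for families over disjoint ground sets.\<close>

definition direct_product :: "'a set set \<Rightarrow> 'a set set \<Rightarrow> 'a set set" where
  "direct_product \<C>1 \<C>2 = {C1 \<union> C2 | C1 C2. C1 \<in> \<C>1 \<and> C2 \<in> \<C>2}"

definition trace_on :: "'a set set \<Rightarrow> 'a set \<Rightarrow> 'a set set" where
  "trace_on \<S> U' = {S \<inter> U' | S. S \<in> \<S>}"

lemma implicational_base_restrict_base:
  assumes "implicational_base U \<Sigma>"
  shows "implicational_base X (restrict_base \<Sigma> X)"
proof -
  have "restrict_base \<Sigma> X \<subseteq> \<Sigma>"
    by (auto simp: restrict_base_def)
  with assms have "finite (restrict_base \<Sigma> X)"
    by (auto simp: implicational_base_def intro: finite_subset)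
  with assms show ?thesis
    by (auto simp: implicational_base_def restrict_base_def)
qed

end

theory Submission
  imports Defs
begin

text \<open>
  If \<open>C1\<close> and \<open>C2\<close> are closed for the two restricted bases, then only implications of
  \<open>\<Sigma>[U1, U2]\<close> can fail in \<open>C1 \<union> C2\<close>. When all of these have their premise in \<open>U1\<close>,
  none fails in \<open>C1 \<union> U2\<close>, as its conclusion lies in \<open>U2\<close>, nor in \<open>{} \<union> C2\<close>, as its
  nonempty premise is not included.
\<close>

text \<open>An implication of \<open>restrict_base \<Sigma> X\<close> lies in
  \<open>\<Sigma>\<close> and has premise and conclusion inside \<open>X\<close>, so it cannot tell
  \<open>C\<close> from \<open>C \<inter> X\<close>.\<close>

lemma closure_system_Int:
  assumes "C \<in> closure_system U \<Sigma>"
  shows "C \<inter> X \<in> closure_system X (restrict_base \<Sigma> X)"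
  using assms by (auto simp: closure_system_def satisfies_def restrict_base_def)

lemma closure_system_subset_direct_product:
  assumes "U = U1 \<union> U2"
  shows "closure_system U \<Sigma> \<subseteq>
    direct_product (closure_system U1 (restrict_base \<Sigma> U1)) (closure_system U2 (restrict_base \<Sigma> U2))"
proof
  fix C assume C: "C \<in> closure_system U \<Sigma>"
  with assms have "C = C \<inter> U1 \<union> C \<inter> U2"
    by (auto simp: closure_system_def)
  with closure_system_Int[OF C, of U1] closure_system_Int[OF C, of U2]
  show "C \<in> direct_product (closure_system U1 (restrict_base \<Sigma> U1)) (closure_system U2 (restrict_base \<Sigma> U2))"
    unfolding direct_product_def by blast
qed

text \<open>The gluing step behind all the reverse inclusions. Disjointness of \<open>U1\<close> and
  \<open>U2\<close> keeps the restricted bases from interacting, so \<open>cross\<close> is the only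
  condition left to check for a particular pair.\<close>

lemma Un_in_closure_system:
  assumes split: "is_split U \<Sigma> U1 U2"
    and C1: "C1 \<in> closure_system U1 (restrict_base \<Sigma> U1)"
    and C2: "C2 \<in> closure_system U2 (restrict_base \<Sigma> U2)"
    and cross: "satisfies (C1 \<union> C2) (cross_base \<Sigma> U1 U2)"
  shows "C1 \<union> C2 \<in> closure_system U \<Sigma>"
proof -
  have sub: "C1 \<subseteq> U1" "C2 \<subseteq> U2"
    using C1 C2 by (auto simp: closure_system_def)
  have "b \<in> C1 \<union> C2" if Ab: "(A, b) \<in> \<Sigma>" and A: "A \<subseteq> C1 \<union> C2" for A b
  proof -
    consider "(A, b) \<in> cross_base \<Sigma> U1 U2" | "(A, b) \<in> restrict_base \<Sigma> U1"
      | "(A, b) \<in> restrict_base \<Sigma> U2"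
      using Ab by (auto simp: cross_base_def)
    then show ?thesis
    proof cases
      case 1
      then show ?thesis using cross A by (auto simp: satisfies_def)
    next
      case 2
      \<comment> \<open>The premise lies in \<open>U1\<close>, which \<open>C2\<close> does not
        meet, so \<open>C2\<close> covers none of it.\<close>
      then have "A \<subseteq> C1"
        using A sub split unfolding restrict_base_def is_split_def by blast
      then show ?thesis
        using 2 C1 by (auto simp: closure_system_def satisfies_def)
    next
      case 3
      then have "A \<subseteq> C2"
        using A sub split unfolding restrict_base_def is_split_def by blast
      then show ?thesis
        using 3 C2 by (auto simp: closure_system_def satisfies_def)
    qed
  qed
  moreover have "C1 \<union> C2 \<subseteq> U"
    using sub split by (auto simp: is_split_def)
  ultimately show ?thesis
    by (auto simp: closure_system_def satisfies_def)
qed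

lemma trace_on_closure_system_subset:
  "trace_on (closure_system U \<Sigma>) X \<subseteq> closure_system X (restrict_base \<Sigma> X)"
  using closure_system_Int by (fastforce simp: trace_on_def)

text \<open>Cross implications act only from \<open>U1\<close> to \<open>U2\<close>. The two traces
  therefore call for opposite extensions: the largest set on the side of \<open>U2\<close>, the
  smallest on the side of \<open>U1\<close>.\<close>

lemma trace_on_closure_system_split:
  assumes base: "implicational_base U \<Sigma>"
    and split: "is_split U \<Sigma> U1 U2"
    and cross: "\<forall>(A, b) \<in> cross_base \<Sigma> U1 U2. A \<subseteq> U1"
  shows "trace_on (closure_system U \<Sigma>) U1 = closure_system U1 (restrict_base \<Sigma> U1)" (is ?trace1)
    and "trace_on (closure_system U \<Sigma>) U2 = closure_system U2 (restrict_base \<Sigma> U2)" (is ?trace2)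
proof -
  have disj: "U1 \<inter> U2 = {}"
    using split by (simp add: is_split_def)
  \<comment> \<open>If \<open>b\<close> were in \<open>U1\<close>, then
    \<open>A \<subseteq> U1\<close> would put the implication into
    \<open>restrict_base \<Sigma> U1\<close>, which \<open>cross_base\<close> excludes.\<close>
  have crossD: "A \<noteq> {} \<and> A \<subseteq> U1 \<and> b \<in> U2" if "(A, b) \<in> cross_base \<Sigma> U1 U2" for A b
    using that base split cross
    by (fastforce simp: implicational_base_def is_split_def cross_base_def restrict_base_def)
  show ?trace1
  proof (rule antisym[OF trace_on_closure_system_subset], rule subsetI)
    fix C assume C: "C \<in> closure_system U1 (restrict_base \<Sigma> U1)"
    \<comment> \<open>Every conclusion of the restricted base lies in \<open>U2\<close>, so the
      whole ground set is closed.\<close>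
    have "U2 \<in> closure_system U2 (restrict_base \<Sigma> U2)"
      by (auto simp: closure_system_def satisfies_def restrict_base_def)
    moreover have "satisfies (C \<union> U2) (cross_base \<Sigma> U1 U2)"
      using crossD by (auto simp: satisfies_def)
    ultimately have "C \<union> U2 \<in> closure_system U \<Sigma>"
      using Un_in_closure_system[OF split C] by blast
    moreover have "C = (C \<union> U2) \<inter> U1"
      using C disj by (auto simp: closure_system_def)
    ultimately show "C \<in> trace_on (closure_system U \<Sigma>) U1"
      unfolding trace_on_def by blast
  qed
  show ?trace2
  proof (rule antisym[OF trace_on_closure_system_subset], rule subsetI)
    fix C assume C: "C \<in> closure_system U2 (restrict_base \<Sigma> U2)"
    then have sub: "C \<subseteq> U2"
      by (simp add: closure_system_def)
    \<comment> \<open>No premise is empty, so every implication holds vacuously in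
      \<open>{}\<close>.\<close>
    have "{} \<in> closure_system U1 (restrict_base \<Sigma> U1)"
      using base
      by (auto simp: closure_system_def satisfies_def restrict_base_def implicational_base_def)
    \<comment> \<open>The redundant \<open>{} \<union> C\<close> keeps the shape
      \<open>C1 \<union> C2\<close> that \<open>Un_in_closure_system\<close> expects.\<close>
    moreover have "satisfies ({} \<union> C) (cross_base \<Sigma> U1 U2)"
      using crossD sub disj by (fastforce simp: satisfies_def)
    ultimately have "{} \<union> C \<in> closure_system U \<Sigma>"
      using Un_in_closure_system[OF split _ C] by blast
    moreover have "C = ({} \<union> C) \<inter> U2"
      using sub by auto
    ultimately show "C \<in> trace_on (closure_system U \<Sigma>) U2"
      unfolding trace_on_def by blast
  qed
qed

lemma is_split_commute: "is_split U \<Sigma> U1 U2 \<longleftrightarrow> is_split U \<Sigma> U2 U1"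
  by (auto simp: is_split_def)

lemma cross_base_commute: "cross_base \<Sigma> U1 U2 = cross_base \<Sigma> U2 U1"
  by (auto simp: cross_base_def)

theorem theorem3:
  fixes U U1 U2 :: "'a set" and \<Sigma> :: "'a implication set" and \<C> \<C>1 \<C>2 :: "'a set set"
  assumes "finite U"
    and "implicational_base U \<Sigma>"
    and "\<C> = closure_system U \<Sigma>"
    and "is_split U \<Sigma> U1 U2"
    and "\<C>1 = closure_system U1 (restrict_base \<Sigma> U1)"
    and "\<C>2 = closure_system U2 (restrict_base \<Sigma> U2)"
  shows "((\<forall>C \<in> \<C>. C \<inter> U1 \<in> \<C>1 \<and> C \<inter> U2 \<in> \<C>2) \<and> \<C> \<subseteq> direct_product \<C>1 \<C>2) \<and>
    (cross_base \<Sigma> U1 U2 = {} \<longrightarrow> \<C> = direct_product \<C>1 \<C>2) \<and>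
    ((\<forall>(A, b) \<in> cross_base \<Sigma> U1 U2. A \<subseteq> U1) \<longrightarrow>
       trace_on \<C> U1 = \<C>1 \<and> trace_on \<C> U2 = \<C>2) \<and>
    ((\<forall>(A, b) \<in> cross_base \<Sigma> U1 U2. A \<subseteq> U2) \<longrightarrow>
       trace_on \<C> U1 = \<C>1 \<and> trace_on \<C> U2 = \<C>2)"
proof (intro conjI impI)
  have U: "U = U1 \<union> U2"
    using assms(4) by (auto simp: is_split_def)
  show "\<forall>C \<in> \<C>. C \<inter> U1 \<in> \<C>1 \<and> C \<inter> U2 \<in> \<C>2"
    using closure_system_Int unfolding assms(3,5,6) by blast
  show sub: "\<C> \<subseteq> direct_product \<C>1 \<C>2"
    unfolding assms(3,5,6) using U by (rule closure_system_subset_direct_product)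
  show "\<C> = direct_product \<C>1 \<C>2" if "cross_base \<Sigma> U1 U2 = {}"
  proof (rule antisym[OF sub], rule subsetI)
    fix C assume "C \<in> direct_product \<C>1 \<C>2"
    then obtain C1 C2 where C: "C = C1 \<union> C2" "C1 \<in> \<C>1" "C2 \<in> \<C>2"
      by (auto simp: direct_product_def)
    have "satisfies (C1 \<union> C2) (cross_base \<Sigma> U1 U2)"
      by (simp add: that satisfies_def)
    with C show "C \<in> \<C>"
      using Un_in_closure_system[OF assms(4)] unfolding assms(3,5,6) by blast
  qed
  show "trace_on \<C> U1 = \<C>1" "trace_on \<C> U2 = \<C>2"
    if "\<forall>(A, b) \<in> cross_base \<Sigma> U1 U2. A \<subseteq> U1"
    unfolding assms(3,5,6) using trace_on_closure_system_split[OF assms(2,4) that] by simp_all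
  \<comment> \<open>The split and the cross base are symmetric in \<open>U1\<close> and
    \<open>U2\<close>, so this is the previous case with the roles exchanged; the two trace
    equations come out in the opposite order.\<close>
  show "trace_on \<C> U1 = \<C>1" "trace_on \<C> U2 = \<C>2"
    if "\<forall>(A, b) \<in> cross_base \<Sigma> U1 U2. A \<subseteq> U2"
    unfolding assms(3,5,6)
    using trace_on_closure_system_split[OF assms(2) is_split_commute[THEN iffD1, OF assms(4)]]
      that[unfolded cross_base_commute[of \<Sigma> U1]] by simp_all
qed

end
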